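(* Let $c_1,\dots,c_k,n,h,\lambda$ be positive integers with $2\leq c_1\leq \cdots\leq c_k\leq n$. For $1\le i\le k$ put $\epsilon_i=\frac{c_ih}{n}-\left\lfloor \frac{c_ih}{n}\right\rfloor$, and suppose that $h\geq \frac{n}{2}+\frac{n(1+\epsilon_i)}{n+c_i}$ for every $i\in\{1,\dots,k\}$. Then $\lambda K_n^h$ can be decomposed into $k$ almost regular spanning cycles of lengths $c_1,\dots,c_k$ if and only if $\sum_{i=1}^k c_i=\lambda\binom{n}{h}$. Moreover, for each $i$ with $\epsilon_i=0$, the corresponding cycle of length $c_i$ in the decomposition is regular.
   Context: $\lambda K_n^h$ is the $\lambda$-fold complete $n$-vertex $h$-uniform hypergraph: its vertex set has $n$ elements and each $h$-subset of the vertex set occurs as an edge exactly $\lambda$ times (the copies being distinct edges). A hypergraph with vertex set $V$ and edge set $E$ is a cycle of length $t$ (a Berge cycle, $t\geq 2$) if there is an alternating sequence $v_1,e_1,v_2,e_2,\dots,v_t,e_t$ of distinct vertices $v_i\in V$ and distinct edges $e_i$ with $E=\{e_1,\dots,e_t\}$ and $\{v_i,v_{i+1}\}\subseteq e_i$ for $1\leq i\leq t$, where $v_{t+1}:=v_1$. (The vertices $v_1,\dots,v_t$ need not be all of $V$.) A cycle is spanning if every vertex of the whole hypergraph belongs to some edge of the cycle. The degree of a vertex is the number of edges containing it; a hypergraph is regular if all its vertices have the same degree, and almost regular if there is an integer $d$ such that every vertex has degree $d$ or $d+1$ (for a spanning cycle this refers to all $n$ vertices, with degrees counted in the cycle). A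 decomposition of a hypergraph is a partition of its edge set; here the $i$-th part is the edge set of the cycle of length $c_i$. *)

theory Defs
  imports Complex_Main "HOL-Library.Disjoint_Sets"
begin

text \<open>Edges have an identity of their own and are mapped to their vertex sets by
  \<open>ends\<close>, so that distinct parallel edges are possible.\<close>

record ('v, 'e) hypergraph =
  verts :: "'v set"
  edges :: "'e set"
  ends :: "'e \<Rightarrow> 'v set"

text \<open>The hypergraph \<open>\<lambda>K\<^sub>n\<^sup>h\<close> on the vertex set \<open>V\<close> with \<open>n = card V\<close>; the edge
  \<open>(S, j)\<close> is the \<open>j\<close>-th copy of the \<open>h\<close>-subset \<open>S\<close>.\<close>

definition complete_hypergraph ::
    "nat \<Rightarrow> 'v set \<Rightarrow> nat \<Rightarrow> ('v, 'v set \<times> nat) hypergraph" where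
  "complete_hypergraph lam V h =
     \<lparr> verts = V,
       edges = {S. S \<subseteq> V \<and> card S = h} \<times> {..<lam},
       ends = fst \<rparr>"

text \<open>All vertices are kept, also those lying on no edge of \<open>F\<close>.\<close>

definition edge_sub :: "('v, 'e) hypergraph \<Rightarrow> 'e set \<Rightarrow> ('v, 'e) hypergraph" where
  "edge_sub H F = \<lparr> verts = verts H, edges = F, ends = ends H \<rparr>"

definition degree :: "('v, 'e) hypergraph \<Rightarrow> 'v \<Rightarrow> nat" where
  "degree H x = card {e \<in> edges H. x \<in> ends H e}"

definition regular :: "('v, 'e) hypergraph \<Rightarrow> bool" where
  "regular H \<longleftrightarrow> (\<exists>d. \<forall>x\<in>verts H. degree H x = d)"

definition almost_regular :: "('v, 'e) hypergraph \<Rightarrow> bool" where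
  "almost_regular H \<longleftrightarrow>
     (\<exists>d. \<forall>x\<in>verts H. degree H x = d \<or> degree H x = d + 1)"

text \<open>Berge cycles of length \<open>t\<close>. The vertices \<open>v 1, \<dots>, v t\<close> need not exhaust \<open>verts H\<close>,
  whereas the edges \<open>e 1, \<dots>, e t\<close> must exhaust \<open>edges H\<close>.\<close>

definition is_cycle :: "('v, 'e) hypergraph \<Rightarrow> nat \<Rightarrow> bool" where
  "is_cycle H t \<longleftrightarrow> t \<ge> 2 \<and>
     (\<exists>v e. inj_on v {1..t} \<and> v ` {1..t} \<subseteq> verts H \<and>
            inj_on e {1..t} \<and> edges H = e ` {1..t} \<and>
            (\<forall>i\<in>{1..t}. {v i, v (if i = t then 1 else i + 1)} \<subseteq> ends H (e i)))"

definition spanning :: "('v, 'e) hypergraph \<Rightarrow> bool" where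
  "spanning H \<longleftrightarrow> (\<forall>x\<in>verts H. \<exists>e\<in>edges H. x \<in> ends H e)"

definition decomposition :: "('v, 'e) hypergraph \<Rightarrow> nat \<Rightarrow> (nat \<Rightarrow> 'e set) \<Rightarrow> bool" where
  "decomposition H k P \<longleftrightarrow>
     disjoint_family_on P {1..k} \<and> (\<Union>i\<in>{1..k}. P i) = edges H \<and> (\<forall>i\<in>{1..k}. P i \<noteq> {})"

definition almost_regular_spanning_cycle_decomposition ::
    "('v, 'e) hypergraph \<Rightarrow> nat \<Rightarrow> (nat \<Rightarrow> nat) \<Rightarrow> (nat \<Rightarrow> 'e set) \<Rightarrow> bool" where
  "almost_regular_spanning_cycle_decomposition H k c P \<longleftrightarrow>
     decomposition H k P \<and>
     (\<forall>i\<in>{1..k}. is_cycle (edge_sub H (P i)) (c i) \<and>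
                 spanning (edge_sub H (P i)) \<and>
                 almost_regular (edge_sub H (P i)))"

end

theory Submission
  imports Defs "HOL-Combinatorics.Transposition"
begin

text \<open>Among all colourings of the edges with class sizes \<open>c\<^sub>1, \<dots>, c\<^sub>k\<close>, one that minimises
  the sum of the squared degrees has almost regular classes: this is Baranyai's theorem, and the
  symmetry of the complete hypergraph under transpositions of vertices allows a direct exchange
  argument. With \<open>q = \<lfloor>c\<^sub>i h / n\<rfloor>\<close> the hypothesis on \<open>h\<close> says \<open>2 (h + q) \<ge> n + c\<^sub>i + 2\<close>,
  where every edge has degree \<open>h\<close> and every vertex degree at least \<open>q\<close> in the incidence graph
  of the \<open>i\<close>-th class. An Ore-type crossing argument then yields a cycle of the incidence graph
  through all edges of the class.\<close>

section \<open>Balanced edge colourings with prescribed class sizes\<close>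

lemma exists_colouring_with_class_sizes:
  assumes "finite I" "finite A" "card A = (\<Sum>i\<in>I. c i)"
  shows "\<exists>f. f ` A \<subseteq> I \<and> (\<forall>i\<in>I. card {a\<in>A. f a = i} = c i)"
  using assms
proof (induction I arbitrary: A rule: finite_induct)
  case empty
  then show ?case by auto
next
  case (insert j I)
  then obtain B where B: "B \<subseteq> A" "card B = c j"
    by (metis le_add1 obtain_subset_with_card_n sum.insert)
  have "card (A - B) = (\<Sum>i\<in>I. c i)"
    using insert B by (simp add: card_Diff_subset finite_subset)
  with insert obtain f where f: "f ` (A - B) \<subseteq> I" "\<forall>i\<in>I. card {a\<in>A-B. f a = i} = c i"
    by (metis finite_Diff)
  define g where "g = (\<lambda>a. if a \<in> B then j else f a)"
  have "g ` A \<subseteq> insert j I"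
    using f(1) by (auto simp: g_def)
  moreover have "{a\<in>A. g a = j} = B"
    using f(1) B(1) insert.hyps by (auto simp: g_def)
  moreover have "{a\<in>A. g a = i} = {a\<in>A-B. f a = i}" if "i \<in> I" for i
    using that insert.hyps by (auto simp: g_def)
  ultimately have "g ` A \<subseteq> insert j I \<and> (\<forall>i\<in>insert j I. card {a\<in>A. g a = i} = c i)"
    using B(2) f(2) by simp
  then show ?case by (rule exI[of _ g])
qed

text \<open>Each \<open>a\<close> is read as an arc from the colour \<open>t a\<close> to the colour
  \<open>u a\<close>; the value is then outdegree minus indegree of \<open>i\<close> among the arcs
  in \<open>B\<close>. Loops contribute nothing.\<close>

definition excess :: "('a \<Rightarrow> 'i) \<Rightarrow> ('a \<Rightarrow> 'i) \<Rightarrow> 'a set \<Rightarrow> 'i \<Rightarrow> int" where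
  "excess t u B i = (\<Sum>a\<in>B. of_bool (t a = i)) - (\<Sum>a\<in>B. of_bool (u a = i))"

lemma excess_insert:
  "finite B \<Longrightarrow> a \<notin> B \<Longrightarrow>
     excess t u (insert a B) i = excess t u B i + of_bool (t a = i) - of_bool (u a = i)"
  by (simp add: excess_def)

text \<open>Arcs with both ends in \<open>Q\<close> cancel, which leaves the arcs leaving
  \<open>Q\<close> minus those entering it.\<close>

lemma sum_excess:
  assumes "finite Q"
  shows "(\<Sum>i\<in>Q. excess t u A i) = (\<Sum>a\<in>A. of_bool (t a \<in> Q) - of_bool (u a \<in> Q))"
proof -
  have *: "(\<Sum>i\<in>Q. of_bool (j = i)) = (of_bool (j \<in> Q) :: int)" for j
    using assms by (simp add: of_bool_def)
  show ?thesis
    unfolding excess_def sum_subtractf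
    by (simp add: sum.swap[of _ A Q] *)
qed

text \<open>\<open>Q\<close> is a maximal set of nodes that are reachable from \<open>i0\<close> by a unit flow inside \<open>Q\<close>;
  no arc leaves it, so its total excess is nonpositive.\<close>

lemma unit_flow_to_negative_excess:
  assumes "finite A" "finite I" "t ` A \<subseteq> I" "u ` A \<subseteq> I" "i0 \<in> I" "excess t u A i0 > 0"
  shows "\<exists>j\<in>I. excess t u A j < 0 \<and>
           (\<exists>B\<subseteq>A. \<forall>i. excess t u B i = of_bool (i = i0) - of_bool (i = j))"
proof -
  define good where "good Q \<longleftrightarrow> Q \<subseteq> I \<and> i0 \<in> Q \<and>
     (\<forall>j\<in>Q. \<exists>B\<subseteq>A. t ` B \<subseteq> Q \<and> u ` B \<subseteq> Q \<and>
        (\<forall>i. excess t u B i = of_bool (i = i0) - of_bool (i = j)))" for Q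
  have "good {i0}"
    using assms(5) by (auto simp: good_def excess_def intro!: exI[of _ "{}"])
  moreover have "\<forall>Q. good Q \<longrightarrow> card Q < Suc (card I)"
    using assms(2) by (auto simp: good_def less_Suc_eq_le card_mono)
  ultimately obtain Q where Q: "good Q" and max: "\<And>Q'. good Q' \<Longrightarrow> card Q' \<le> card Q"
    using ex_has_greatest_nat[of good "{i0}" card] by blast
  have QI: "Q \<subseteq> I" "i0 \<in> Q" "finite Q"
    using Q assms(2) finite_subset by (auto simp: good_def)
  have flow: "\<exists>B\<subseteq>A. t ` B \<subseteq> Q \<and> u ` B \<subseteq> Q \<and>
      (\<forall>i. excess t u B i = of_bool (i = i0) - of_bool (i = j))" if "j \<in> Q" for j
    using Q that by (simp add: good_def)
  have closed: "u a \<in> Q" if a: "a \<in> A" "t a \<in> Q" for a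
  proof (rule ccontr)
    assume notin: "u a \<notin> Q"
    \<comment> \<open>Appending \<open>a\<close> to a flow that ends at \<open>t a\<close> yields
      one that ends at \<open>u a\<close>. The arc is new, since all arcs of the old flow have their
      heads in \<open>Q\<close>.\<close>
    have "good (insert (u a) Q)"
      unfolding good_def
    proof (intro conjI ballI)
      fix j assume "j \<in> insert (u a) Q"
      then consider "j \<in> Q" | "j = u a" by auto
      then show "\<exists>B\<subseteq>A. t ` B \<subseteq> insert (u a) Q \<and> u ` B \<subseteq> insert (u a) Q \<and>
                  (\<forall>i. excess t u B i = of_bool (i = i0) - of_bool (i = j))"
      proof cases
        case 1
        then obtain B where "B \<subseteq> A" "t ` B \<subseteq> Q" "u ` B \<subseteq> Q"
          "\<forall>i. excess t u B i = of_bool (i = i0) - of_bool (i = j)"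
          using flow[OF 1] by (elim exE conjE)
        then show ?thesis by (intro exI[of _ B] conjI subset_insertI2)
      next
        case 2
        obtain B where B: "B \<subseteq> A" "t ` B \<subseteq> Q" "u ` B \<subseteq> Q"
          "\<forall>i. excess t u B i = of_bool (i = i0) - of_bool (i = t a)"
          using flow[OF a(2)] by (elim exE conjE)
        have "a \<notin> B" using B(3) notin by auto
        moreover have "finite B" using B(1) assms(1) finite_subset by blast
        ultimately have "excess t u (insert a B) i = of_bool (i = i0) - of_bool (i = j)" for i
          using B(4) 2 by (auto simp: excess_insert)
        then show ?thesis
          using B a by (intro exI[of _ "insert a B"]) auto
      qed
    qed (use QI a assms(4) in auto)
    with max[of "insert (u a) Q"] notin QI show False by simp
  qed
  have "(\<Sum>i\<in>Q. excess t u A i) \<le> 0"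
    unfolding sum_excess[OF QI(3)] using closed by (intro sum_nonpos) auto
  \<comment> \<open>\<open>i0\<close> lies in \<open>Q\<close> and has positive excess, so the
    nonpositive total forces a negative value elsewhere in \<open>Q\<close>.\<close>
  then obtain j where "j \<in> Q" "excess t u A j < 0"
    using assms(6) sum_pos2[OF QI(3,2), of "excess t u A"] by (meson linorder_not_le)
  then obtain B where "B \<subseteq> A" "\<forall>i. excess t u B i = of_bool (i = i0) - of_bool (i = j)"
    using flow by meson
  then show ?thesis
    using QI(1) \<open>j \<in> Q\<close> \<open>excess t u A j < 0\<close> by (intro bexI[of _ j] conjI exI[of _ B]) auto
qed

lemma sum_of_bool_card: "finite A \<Longrightarrow> (\<Sum>a\<in>A. of_bool (P a)) = int (card {a\<in>A. P a})"
  by (simp add: Int_def)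

definition class_degree :: "('v set \<times> 'b) set \<Rightarrow> ('v set \<times> 'b \<Rightarrow> 'i) \<Rightarrow> 'i \<Rightarrow> 'v \<Rightarrow> nat" where
  "class_degree D f i z = card {e\<in>D. f e = i \<and> z \<in> fst e}"

text \<open>For vertices \<open>x\<close>, \<open>y\<close>, exchanging \<open>x\<close> and \<open>y\<close> matches the edges
  containing only \<open>x\<close> with those containing only \<open>y\<close>; each such pair is an arc
  between the two colours involved, and interchanging these colours reverses the arc. Pushing a
  unit flow from a colour with excess at least 2 to one with negative excess lowers the sum of
  squared degrees.\<close>

lemma balanced_colouring:
  fixes c :: "'i \<Rightarrow> nat" and V :: "'v set" and lam h :: nat
  defines "D \<equiv> {S. S \<subseteq> V \<and> card S = h} \<times> {..<lam}"
  assumes "finite V" "finite I" "card D = (\<Sum>i\<in>I. c i)"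
  shows "\<exists>f. f ` D \<subseteq> I \<and> (\<forall>i\<in>I. card {e\<in>D. f e = i} = c i) \<and>
           (\<forall>i\<in>I. \<forall>x\<in>V. \<forall>y\<in>V. class_degree D f i x \<le> class_degree D f i y + 1)"
proof -
  have finD: "finite D" using assms by (auto simp: D_def)
  define ok where "ok f \<longleftrightarrow> f ` D \<subseteq> I \<and> (\<forall>i\<in>I. card {e\<in>D. f e = i} = c i)" for f
  define pot where "pot f = (\<Sum>i\<in>I. \<Sum>z\<in>V. (class_degree D f i z)\<^sup>2)" for f
  have "\<exists>f. ok f"
    using exists_colouring_with_class_sizes[OF assms(3) finD assms(4)] by (simp add: ok_def)
  then obtain f where f: "ok f" and min: "\<And>g. ok g \<Longrightarrow> pot f \<le> pot g"
    using ex_has_least_nat[of ok _ pot] by blast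
  have False if i0: "i0 \<in> I" and xy: "x \<in> V" "y \<in> V"
    and big: "class_degree D f i0 x > class_degree D f i0 y + 1" for i0 x y
  proof -
    have "x \<noteq> y" using big by auto
    define \<tau> where "\<tau> e = (transpose x y ` fst e, snd e)" for e :: "'v set \<times> nat"
    have \<tau>\<tau> [simp]: "\<tau> (\<tau> e) = e" for e by (simp add: \<tau>_def image_comp)
    have \<tau>D [simp]: "\<tau> e \<in> D \<longleftrightarrow> e \<in> D" for e
    proof -
      have "\<tau> e \<in> D" if "e \<in> D" for e
      proof -
        have "transpose x y ` fst e \<subseteq> V"
          using that xy by (force simp: D_def transpose_def)
        then show ?thesis using that by (auto simp: \<tau>_def D_def card_image)
      qed
      then show ?thesis by (metis \<tau>\<tau>)
    qed
    have mem: "x \<in> fst (\<tau> e) \<longleftrightarrow> y \<in> fst e" "y \<in> fst (\<tau> e) \<longleftrightarrow> x \<in> fst e" for e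
      by (auto simp: \<tau>_def image_iff transpose_def)
    have mem': "z \<in> fst (\<tau> e) \<longleftrightarrow> z \<in> fst e" if "z \<noteq> x" "z \<noteq> y" for z e
      using that by (auto simp: \<tau>_def image_iff transpose_def)
    \<comment> \<open>\<open>\<tau>\<close> pairs each edge of \<open>A\<close> with one containing
      \<open>y\<close> but not \<open>x\<close>, so \<open>A\<close> indexes the pairs.\<close>
    define A where "A = {e\<in>D. x \<in> fst e \<and> y \<notin> fst e}"
    define C where "C = {e\<in>D. x \<in> fst e \<and> y \<in> fst e}"
    have fin: "finite A" "finite C" using finD by (auto simp: A_def C_def)
    have degx: "int (class_degree D g i x) =
        (\<Sum>e\<in>A. of_bool (g e = i)) + (\<Sum>e\<in>C. of_bool (g e = i))" for g i
    proof -
      have "{e\<in>D. g e = i \<and> x \<in> fst e} = {e\<in>A. g e = i} \<union> {e\<in>C. g e = i}"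
        by (auto simp: A_def C_def)
      moreover have "{e\<in>A. g e = i} \<inter> {e\<in>C. g e = i} = {}"
        by (auto simp: A_def C_def)
      ultimately show ?thesis
        unfolding class_degree_def fin[THEN sum_of_bool_card] using fin by (simp add: card_Un_disjoint)
    qed
    have degy: "int (class_degree D g i y) =
        (\<Sum>e\<in>A. of_bool (g (\<tau> e) = i)) + (\<Sum>e\<in>C. of_bool (g e = i))" for g i
    proof -
      have "{e\<in>D. g e = i \<and> y \<in> fst e} = {e\<in>D. g e = i \<and> y \<in> fst e \<and> x \<notin> fst e} \<union> {e\<in>C. g e = i}"
        unfolding C_def by blast
      moreover have "{e\<in>D. g e = i \<and> y \<in> fst e \<and> x \<notin> fst e} \<inter> {e\<in>C. g e = i} = {}"
        unfolding C_def by blast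
      moreover have "card {e\<in>D. g e = i \<and> y \<in> fst e \<and> x \<notin> fst e} = card {e\<in>A. g (\<tau> e) = i}"
        by (rule bij_betw_same_card[of \<tau>], rule bij_betwI[of _ _ _ \<tau>]) (simp_all add: A_def mem)
      ultimately show ?thesis
        unfolding class_degree_def fin[THEN sum_of_bool_card] using fin finD
        by (simp add: card_Un_disjoint)
    qed
    \<comment> \<open>The edges in \<open>C\<close> count equally for \<open>x\<close> and
      \<open>y\<close>, so only the arcs from \<open>f e\<close> to \<open>f (\<tau> e)\<close>
      contribute to the degree difference.\<close>
    have exc: "excess f (f \<circ> \<tau>) A i = int (class_degree D f i x) - int (class_degree D f i y)" for i
      by (simp add: excess_def degx degy)
    have "f ` A \<subseteq> I" "(f \<circ> \<tau>) ` A \<subseteq> I"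
      using f by (auto simp: ok_def A_def)
    from unit_flow_to_negative_excess[OF fin(1) assms(3) this i0]
    obtain j B where j: "j \<in> I" "excess f (f \<circ> \<tau>) A j < 0" and B: "B \<subseteq> A"
      "\<And>i. excess f (f \<circ> \<tau>) B i = of_bool (i = i0) - of_bool (i = j)"
      using big exc by auto
    \<comment> \<open>Colours are interchanged only on the pairs selected by \<open>B\<close>. Being
      an involution of \<open>D\<close>, \<open>\<sigma>\<close> preserves all class sizes.\<close>
    define \<sigma> where "\<sigma> e = (if e \<in> B \<or> \<tau> e \<in> B then \<tau> e else e)" for e
    define g where "g = f \<circ> \<sigma>"
    have \<sigma>\<sigma> [simp]: "\<sigma> (\<sigma> e) = e" for e by (simp add: \<sigma>_def)
    have \<sigma>D [simp]: "\<sigma> e \<in> D \<longleftrightarrow> e \<in> D" for e by (simp add: \<sigma>_def)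
    have card_\<sigma>: "card {e\<in>D. P (\<sigma> e) e} = card {e\<in>D. P e (\<sigma> e)}" for P
      by (rule bij_betw_same_card[of \<sigma>], rule bij_betwI[of _ _ _ \<sigma>]) auto
    have "ok g"
      using f card_\<sigma>[of "\<lambda>e _. f e = _"] by (auto simp: ok_def g_def)
    have other: "class_degree D g i z = class_degree D f i z" if "z \<noteq> x" "z \<noteq> y" for i z
    proof -
      have "z \<in> fst (\<sigma> e) \<longleftrightarrow> z \<in> fst e" for e
        using that by (simp add: \<sigma>_def mem')
      then show ?thesis
        unfolding class_degree_def g_def using card_\<sigma>[of "\<lambda>e e'. f e = i \<and> z \<in> fst e'"] by simp
    qed
    have \<tau>A: "\<tau> e \<notin> B" if "e \<in> A" for e
      using that B(1) by (auto simp: A_def mem)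
    have splitA: "(\<Sum>e\<in>A. k e) = (\<Sum>e\<in>A-B. k e) + (\<Sum>e\<in>B. k e)" for k :: "_ \<Rightarrow> int"
      using B(1) fin by (metis sum.subset_diff)
    have gC: "(\<Sum>e\<in>C. of_bool (g e = i)) = (\<Sum>e\<in>C. of_bool (f e = i) :: int)" for i
    proof -
      have "e \<notin> B" "\<tau> e \<notin> B" if "e \<in> C" for e
        using that subsetD[OF B(1), of e] subsetD[OF B(1), of "\<tau> e"] by (auto simp: A_def C_def mem)
      then show ?thesis by (simp add: g_def \<sigma>_def)
    qed
    have g1: "(\<Sum>e\<in>A-B. of_bool (g e = i)) = (\<Sum>e\<in>A-B. of_bool (f e = i) :: int)"
      "(\<Sum>e\<in>A-B. of_bool (g (\<tau> e) = i)) = (\<Sum>e\<in>A-B. of_bool (f (\<tau> e) = i) :: int)" for i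
      by (intro sum.cong; auto simp: g_def \<sigma>_def \<tau>A)+
    have g2: "(\<Sum>e\<in>B. of_bool (g e = i)) = (\<Sum>e\<in>B. of_bool (f (\<tau> e) = i) :: int)"
      "(\<Sum>e\<in>B. of_bool (g (\<tau> e) = i)) = (\<Sum>e\<in>B. of_bool (f e = i) :: int)" for i
      by (intro sum.cong; auto simp: g_def \<sigma>_def)+
    have excB: "(\<Sum>e\<in>B. of_bool (f e = i)) - (\<Sum>e\<in>B. of_bool (f (\<tau> e) = i)) =
        (of_bool (i = i0) - of_bool (i = j) :: int)" for i
      using B(2)[of i] by (simp add: excess_def)
    \<comment> \<open>Reversing the unit flow moves one unit of degree: colour \<open>i0\<close>
      loses one at \<open>x\<close> and gains one at \<open>y\<close>, and \<open>j\<close> does the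
      opposite.\<close>
    have gx: "int (class_degree D g i x) =
        int (class_degree D f i x) - (of_bool (i = i0) - of_bool (i = j))" for i
      using excB[of i] unfolding degx splitA gC g1 g2 by linarith
    have gy: "int (class_degree D g i y) =
        int (class_degree D f i y) + (of_bool (i = i0) - of_bool (i = j))" for i
      using excB[of i] unfolding degy splitA gC g1 g2 by linarith
    define sq :: "('v set \<times> nat \<Rightarrow> 'i) \<Rightarrow> 'i \<Rightarrow> nat" where "sq g i = (\<Sum>z\<in>V. (class_degree D g i z)\<^sup>2)" for g i
    have sq: "int (sq g i) = int (\<Sum>z\<in>V-{x,y}. (class_degree D g i z)\<^sup>2) +
        (int (class_degree D g i x))\<^sup>2 + (int (class_degree D g i y))\<^sup>2" for g i
      unfolding sq_def using sum.subset_diff[of "{x,y}" V "\<lambda>z. (class_degree D g i z)\<^sup>2"] xy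
        \<open>x \<noteq> y\<close> assms(2) by simp
    have sq_other: "(\<Sum>z\<in>V-{x,y}. (class_degree D g i z)\<^sup>2) =
        (\<Sum>z\<in>V-{x,y}. (class_degree D f i z)\<^sup>2)" for i
      by (intro sum.cong) (auto simp: other)
    have "i0 \<noteq> j" using big j exc[of i0] by auto
    have e_j: "int (class_degree D f j x) - int (class_degree D f j y) \<le> -1"
      using j(2) exc[of j] by simp
    have e_i0: "int (class_degree D f i0 x) - int (class_degree D f i0 y) \<ge> 2"
      using big by simp
    \<comment> \<open>For degrees a at \<open>x\<close> and b at \<open>y\<close>, (a-1)^2 + (b+1)^2
      = a^2 + b^2 - 2(a-b) + 2, which is a strict drop once a-b is at least 2. For \<open>j\<close>
      the roles of \<open>x\<close> and \<open>y\<close> are exchanged, and a-b at most -1 already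
      rules out an increase.\<close>
    have "sq g i0 < sq f i0"
    proof -
      have "int (sq g i0) = int (sq f i0)
          - 2 * (int (class_degree D f i0 x) - int (class_degree D f i0 y)) + 2"
        unfolding sq sq_other gx gy using \<open>i0 \<noteq> j\<close> by (simp add: power2_eq_square algebra_simps)
      then have "int (sq g i0) < int (sq f i0)" using e_i0 by simp
      then show ?thesis by simp
    qed
    moreover have "sq g i \<le> sq f i" for i
    proof -
      consider "i = i0" | "i = j" | "i \<noteq> i0" "i \<noteq> j" by blast
      then show ?thesis
      proof cases
        case 1
        then show ?thesis using \<open>sq g i0 < sq f i0\<close> by simp
      next
        case 2
        have "int (sq g j) = int (sq f j)
            + 2 * (int (class_degree D f j x) - int (class_degree D f j y)) + 2"
          unfolding sq sq_other gx gy using \<open>i0 \<noteq> j\<close> by (simp add: power2_eq_square algebra_simps)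
        then have "int (sq g j) \<le> int (sq f j)" using e_j by simp
        then show ?thesis using 2 by simp
      next
        case 3
        then have "int (sq g i) = int (sq f i)"
          unfolding sq sq_other gx gy by simp
        then show ?thesis by simp
      qed
    qed
    ultimately have "pot g < pot f"
      unfolding pot_def sq_def[symmetric] using i0 assms(3) by (intro sum_strict_mono_ex1) auto
    with min[OF \<open>ok g\<close>] show False by simp
  qed
  then show ?thesis
    using f by (intro exI[of _ f]) (auto simp: ok_def not_less[symmetric])
qed

section \<open>Covering paths and cycles in bipartite graphs\<close>

text \<open>A walk \<open>xs ! 0\<close>, \<open>ys ! 0\<close>, \<open>xs ! 1\<close>, ... in a
  bipartite graph that starts and ends on the \<open>xs\<close> side. With the sides in separate
  lists, distinctness and coverage can be required of each one separately.\<close>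

definition alternating :: "('x \<Rightarrow> 'y \<Rightarrow> bool) \<Rightarrow> 'x list \<Rightarrow> 'y list \<Rightarrow> bool" where
  "alternating E xs ys \<longleftrightarrow> length xs = Suc (length ys) \<and>
     (\<forall>i<length ys. E (xs ! i) (ys ! i) \<and> E (xs ! Suc i) (ys ! i))"

text \<open>Serves to cut a walk at the node \<open>y\<close> and to glue pieces together again,
  reversed or interchanged, by checking only the two adjacencies at the junction.\<close>

lemma alternating_append:
  assumes "length as = Suc (length as')" "length bs = Suc (length bs')"
  shows "alternating E (as @ bs) (as' @ y # bs') \<longleftrightarrow>
           alternating E as as' \<and> alternating E bs bs' \<and> E (last as) y \<and> E (hd bs) y"
proof -
  have ne: "as \<noteq> []" "bs \<noteq> []" using assms by auto
  let ?Q = "\<lambda>i. E ((as @ bs) ! i) ((as' @ y # bs') ! i) \<and> E ((as @ bs) ! Suc i) ((as' @ y # bs') ! i)"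
  have "(\<forall>i < length as' + Suc (length bs'). ?Q i) \<longleftrightarrow>
      (\<forall>i < length as'. ?Q i) \<and> ?Q (length as') \<and> (\<forall>i < length bs'. ?Q (Suc (length as') + i))"
  proof (intro iffI conjI allI impI)
    fix i assume *: "(\<forall>i < length as'. ?Q i) \<and> ?Q (length as') \<and>
        (\<forall>i < length bs'. ?Q (Suc (length as') + i))" "i < length as' + Suc (length bs')"
    have "?Q i"
    proof (cases i "length as'" rule: linorder_cases)
      case greater
      then obtain j where "i = Suc (length as') + j"
        using less_imp_Suc_add by fastforce
      with * show ?thesis by simp
    qed (use * in blast)+
    then show "E ((as @ bs) ! i) ((as' @ y # bs') ! i)"
      "E ((as @ bs) ! Suc i) ((as' @ y # bs') ! i)" by blast+
  qed (simp_all, auto dest: spec[of _ "length as'"])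
  moreover have "?Q i \<longleftrightarrow> E (as ! i) (as' ! i) \<and> E (as ! Suc i) (as' ! i)" if "i < length as'" for i
    using that assms by (simp add: nth_append)
  moreover have "?Q (length as') \<longleftrightarrow> E (last as) y \<and> E (hd bs) y"
    using assms ne by (simp add: nth_append last_conv_nth hd_conv_nth)
  moreover have "?Q (Suc (length as') + i) \<longleftrightarrow> E (bs ! i) (bs' ! i) \<and> E (bs ! Suc i) (bs' ! i)" for i
    using assms by (simp add: nth_append)
  ultimately show ?thesis
    using assms by (simp add: alternating_def) blast
qed

lemma alternating_rev:
  assumes "alternating E xs ys"
  shows "alternating E (rev xs) (rev ys)"
proof -
  have "E (rev xs ! i) (rev ys ! i) \<and> E (rev xs ! Suc i) (rev ys ! i)" if "i < length ys" for i
  proof -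
    define j where "j = length ys - Suc i"
    have "j < length ys" "rev ys ! i = ys ! j" "rev xs ! i = xs ! Suc j" "rev xs ! Suc i = xs ! j"
      using that assms by (auto simp: j_def rev_nth alternating_def Suc_diff_Suc)
    then show ?thesis using assms by (simp add: alternating_def)
  qed
  then show ?thesis using assms by (simp add: alternating_def)
qed

text \<open>\<open>X\<close> will hold the hyperedges of a colour class and \<open>Y\<close> the
  vertices. A Berge cycle exhausts its hyperedges but may skip vertices, so only \<open>X\<close>
  has to be covered.\<close>

definition covering_path :: "('x \<Rightarrow> 'y \<Rightarrow> bool) \<Rightarrow> 'x set \<Rightarrow> 'y set \<Rightarrow> 'x list \<Rightarrow> 'y list \<Rightarrow> bool" where
  "covering_path E X Y xs ys \<longleftrightarrow>
     alternating E xs ys \<and> distinct xs \<and> distinct ys \<and> set xs = X \<and> set ys \<subseteq> Y"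

text \<open>A cycle is stored cut open at one of its \<open>Y\<close>-nodes,
  \<open>w\<close>.\<close>

definition covering_cycle :: "('x \<Rightarrow> 'y \<Rightarrow> bool) \<Rightarrow> 'x set \<Rightarrow> 'y set \<Rightarrow> 'x list \<Rightarrow> 'y list \<Rightarrow> 'y \<Rightarrow> bool" where
  "covering_cycle E X Y xs ys w \<longleftrightarrow>
     covering_path E X Y xs ys \<and> w \<in> Y - set ys \<and> E (hd xs) w \<and> E (last xs) w"

lemma covering_path_rev: "covering_path E X Y xs ys \<Longrightarrow> covering_path E X Y (rev xs) (rev ys)"
  by (simp add: covering_path_def alternating_rev)

lemma covering_path_ne: "covering_path E X Y xs ys \<Longrightarrow> xs \<noteq> []"
  by (auto simp: covering_path_def alternating_def)

text \<open>If the first vertex of the path is adjacent to \<open>ys ! i\<close> and \<open>xs ! i\<close> is adjacent to \<open>w\<close>,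
  then reversing the initial segment of the path up to \<open>xs ! i\<close> and closing with \<open>w\<close>
  gives a cycle.\<close>

lemma crossing_bound:
  assumes path: "covering_path E X Y xs ys" and w: "w \<in> Y - set ys" "E (last xs) w"
    and none: "\<nexists>xs ys w. covering_cycle E X Y xs ys w"
  shows "card {x\<in>X. E x w} + card {y\<in>set ys. E (hd xs) y} \<le> card X"
proof -
  have alt: "alternating E xs ys" and len: "length xs = Suc (length ys)"
    and props: "distinct xs" "distinct ys" "set xs = X" "set ys \<subseteq> Y"
    using path by (auto simp: covering_path_def alternating_def)
  define J where "J = {i. i < length ys \<and> E (hd xs) (ys ! i)}"
  have "{y\<in>set ys. E (hd xs) y} = (\<lambda>i. ys ! i) ` J"
    by (auto simp: J_def in_set_conv_nth)
  moreover have "inj_on (\<lambda>i. ys ! i) J"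
    using props by (auto simp: J_def inj_on_def nth_eq_iff_index_eq)
  ultimately have cardJ: "card {y\<in>set ys. E (hd xs) y} = card J"
    by (simp add: card_image)
  have nonadj: "\<not> E (xs ! i) w" if "i \<in> J" for i
  proof
    assume Ew: "E (xs ! i) w"
    have i: "i < length ys" "E (hd xs) (ys ! i)" using that by (auto simp: J_def)
    define as bs as' bs' where ab: "as = take (Suc i) xs" "bs = drop (Suc i) xs"
      "as' = take i ys" "bs' = drop (Suc i) ys"
    have xs: "xs = as @ bs" and ys: "ys = as' @ ys ! i # bs'"
      using i by (simp_all add: ab id_take_nth_drop)
    have lens: "length as = Suc (length as')" "length bs = Suc (length bs')"
      using i len by (auto simp: ab)
    then have ne: "as \<noteq> []" "bs \<noteq> []" by auto
    have "alternating E (as @ bs) (as' @ ys ! i # bs')"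
      using alt xs ys by simp
    then have "alternating E as as'" "alternating E bs bs'" "E (hd bs) (ys ! i)"
      unfolding alternating_append[OF lens] by auto
    moreover have hdas: "hd as = hd xs" using ne xs by (metis hd_append2)
    ultimately have "alternating E (rev as @ bs) (rev as' @ ys ! i # bs')"
      using i ne lens by (simp add: alternating_append alternating_rev last_rev)
    moreover have "distinct (as' @ ys ! i # bs')" "set (as' @ ys ! i # bs') = set ys"
      using props(2) ys by metis+
    then have "distinct (rev as' @ ys ! i # bs')" "set (rev as' @ ys ! i # bs') = set ys"
      by simp_all
    moreover have "distinct (as @ bs)" "set (as @ bs) = X"
      using props xs by metis+
    then have "distinct (rev as @ bs)" "set (rev as @ bs) = X"
      by simp_all
    moreover have "hd (rev as @ bs) = xs ! i"
      using ne i len by (simp add: hd_rev ab take_Suc_conv_app_nth)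
    moreover have "last (rev as @ bs) = last xs" using ne xs by simp
    ultimately have "covering_cycle E X Y (rev as @ bs) (rev as' @ ys ! i # bs') w"
      using w Ew props by (simp add: covering_cycle_def covering_path_def)
    with none show False by blast
  qed
  \<comment> \<open>The map from \<open>i\<close> to \<open>xs ! i\<close> embeds \<open>J\<close>
    into the non-neighbours of \<open>w\<close>, which gives the bound.\<close>
  have "inj_on (\<lambda>i. xs ! i) J"
    using props len by (auto simp: J_def inj_on_def nth_eq_iff_index_eq)
  then have "card J = card ((\<lambda>i. xs ! i) ` J)" by (simp add: card_image)
  moreover have "(\<lambda>i. xs ! i) ` J \<subseteq> X - {x\<in>X. E x w}"
    using nonadj props(3) len by (auto simp: J_def)
  moreover have "finite X" using props(3) by auto
  ultimately have "card J \<le> card X - card {x\<in>X. E x w}"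
    by (metis (no_types, lifting) card_Diff_subset card_mono finite_Diff mem_Collect_eq rev_finite_subset subsetI)
  moreover have "card {x\<in>X. E x w} \<le> card X"
    using \<open>finite X\<close> by (intro card_mono) auto
  ultimately show ?thesis using cardJ by linarith
qed

text \<open>The cycle is cut open at \<open>y\<close> instead of \<open>w\<close>; \<open>w\<close>
  becomes the junction between the two pieces of the old path, taken in the opposite order.\<close>

lemma covering_cycle_rotate:
  assumes "covering_cycle E X Y xs ys w" "y \<in> set ys"
  shows "\<exists>xs ys. covering_cycle E X Y xs ys y"
proof -
  have alt: "alternating E xs ys" and len: "length xs = Suc (length ys)"
    and props: "distinct xs" "distinct ys" "set xs = X" "set ys \<subseteq> Y" "w \<in> Y" "w \<notin> set ys"
      "E (hd xs) w" "E (last xs) w"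
    using assms by (auto simp: covering_path_def alternating_def covering_cycle_def)
  obtain as' bs' where ys: "ys = as' @ y # bs'"
    using assms(2) by (meson split_list)
  define as bs where ab: "as = take (Suc (length as')) xs" "bs = drop (Suc (length as')) xs"
  have xs: "xs = as @ bs" by (simp add: ab)
  have lens: "length as = Suc (length as')" "length bs = Suc (length bs')"
    using len ys by (auto simp: ab)
  then have ne: "as \<noteq> []" "bs \<noteq> []" by auto
  have "alternating E as as'" "alternating E bs bs'" "E (last as) y" "E (hd bs) y"
    using alt unfolding xs ys alternating_append[OF lens] by auto
  then have "covering_cycle E X Y (bs @ as) (bs' @ w # as') y"
    using props lens ne ys xs
    by (auto simp: covering_cycle_def covering_path_def alternating_append)
  then show ?thesis by blast
qed

text \<open>The cycle must use the new edge from \<open>x\<close> to \<open>y\<close>, as there is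
  none without it. Rotated so as to close at \<open>y\<close>, it loses only a closing edge when the
  new edge is removed, so a path with end \<open>x\<close> remains; reversal puts \<open>x\<close>
  first.\<close>

lemma covering_path_of_added_edge:
  assumes cyc: "covering_cycle (\<lambda>u v. E u v \<or> u = x \<and> v = y) X Y xs ys w"
    and none: "\<nexists>xs ys w. covering_cycle E X Y xs ys w" and X: "card X \<ge> 2"
  shows "\<exists>xs ys. covering_path E X Y xs ys \<and> y \<in> Y - set ys \<and> hd xs = x \<and> E (last xs) y"
proof -
  let ?E = "\<lambda>u v. E u v \<or> u = x \<and> v = y"
  have avoid: "covering_path E X Y xs ys" if "covering_path ?E X Y xs ys" "y \<notin> set ys" for xs ys
    using that by (auto simp: covering_path_def alternating_def)
  have "y \<in> set ys \<or> y = w"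
  proof (rule ccontr)
    assume "\<not> (y \<in> set ys \<or> y = w)"
    then have "covering_cycle E X Y xs ys w"
      using cyc avoid[of xs ys] by (auto simp: covering_cycle_def)
    with none show False by blast
  qed
  then obtain xs ys where *: "covering_cycle ?E X Y xs ys y"
    using covering_cycle_rotate[OF cyc] cyc by blast
  have path: "covering_path E X Y xs ys" and y: "y \<in> Y - set ys"
    using * avoid[of xs ys] by (auto simp: covering_cycle_def)
  have ends: "E (hd xs) y \<or> hd xs = x" "E (last xs) y \<or> last xs = x"
    using * by (auto simp: covering_cycle_def)
  have "\<not> (E (hd xs) y \<and> E (last xs) y)"
    using none path y by (auto simp: covering_cycle_def)
  \<comment> \<open>Since \<open>X\<close> has at least two elements, the path ends differ and only
    one of them can be \<open>x\<close>.\<close>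
  moreover have "hd xs \<noteq> last xs"
  proof
    assume "hd xs = last xs"
    moreover have "distinct xs" "set xs = X" using path by (auto simp: covering_path_def)
    ultimately have "length xs = 1"
      using covering_path_ne[OF path]
      by (cases xs) (auto split: if_splits)
    then show False using X \<open>set xs = X\<close> card_length[of xs] by simp
  qed
  ultimately consider "hd xs = x" "E (last xs) y" | "last xs = x" "E (hd xs) y"
    using ends by auto
  then show ?thesis
  proof cases
    case 1
    with path y show ?thesis by blast
  next
    case 2
    with covering_path_rev[OF path] y covering_path_ne[OF path] show ?thesis
      by (intro exI[of _ "rev xs"] exI[of _ "rev ys"]) (simp add: hd_rev last_rev)
  qed
qed

text \<open>Edges are removed one at a time from the complete bipartite graph, so that the last cycle
  breaks up into a covering path, whose last but not first vertex is adjacent to a vertex \<open>y\<close> off the path. The sets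
  \<open>A\<close>, \<open>B\<close> of neighbours of the two path ends off the path are disjoint, and the crossing
  bound, applied at \<open>y \<in> B\<close> and at some \<open>z \<in> A\<close>, contradicts the degree sum.\<close>

lemma exists_covering_cycle:
  fixes E :: "'x \<Rightarrow> 'y \<Rightarrow> bool"
  assumes fin: "finite X" "finite Y" and card: "2 \<le> card X" "card X \<le> card Y"
    and degX: "\<And>x. x \<in> X \<Longrightarrow> h \<le> card {y\<in>Y. E x y}"
    and degY: "\<And>y. y \<in> Y \<Longrightarrow> d \<le> card {x\<in>X. E x y}"
    and sum: "card X + card Y + 2 \<le> 2 * (h + d)"
  shows "\<exists>xs ys w. covering_cycle E X Y xs ys w"
  using degX degY
\<comment> \<open>The measure counts missing edges, so the induction hypothesis concerns graphs with
  more edges.\<close>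
proof (induction "card {p \<in> X \<times> Y. \<not> E (fst p) (snd p)}" arbitrary: E rule: less_induct)
  case less
  show ?case
  proof (cases "\<forall>x\<in>X. \<forall>y\<in>Y. E x y")
    case True
    \<comment> \<open>In the complete bipartite graph any ordering of \<open>X\<close> works, with
      \<open>card X\<close> distinct nodes of \<open>Y\<close>, one of them reserved for closing the
      cycle.\<close>
    obtain xs where xs: "set xs = X" "distinct xs"
      using fin(1) finite_distinct_list by blast
    obtain Y' where Y': "Y' \<subseteq> Y" "card Y' = card X"
      using card(2) obtain_subset_with_card_n by blast
    then obtain ws where ws: "set ws = Y'" "distinct ws"
      using fin(2) finite_distinct_list finite_subset by metis
    have len: "length xs = card X" "length ws = card X"
      using xs ws Y' distinct_card by metis+
    then obtain w ys where wys: "ws = w # ys" using card by (cases ws) auto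
    have "alternating E xs ys"
      unfolding alternating_def
    proof (intro conjI allI impI)
      show "length xs = Suc (length ys)" using len wys by simp
      fix i assume i: "i < length ys"
      then have "i < length xs" "Suc i < length xs" "ys ! i \<in> set ws"
        using len wys by auto
      then have "xs ! i \<in> X" "xs ! Suc i \<in> X" "ys ! i \<in> Y"
        using xs(1) ws(1) Y'(1) nth_mem[of _ xs] by blast+
      then show "E (xs ! i) (ys ! i)" "E (xs ! Suc i) (ys ! i)" using True by auto
    qed
    moreover have "xs \<noteq> []" using len card by auto
    ultimately have "covering_cycle E X Y xs ys w"
      using xs ws wys Y' True by (auto simp: covering_cycle_def covering_path_def)
    then show ?thesis by blast
  next
    case False
    then obtain x y where xy: "x \<in> X" "y \<in> Y" "\<not> E x y" by auto
    let ?E = "\<lambda>u v. E u v \<or> u = x \<and> v = y"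
    show ?thesis
    proof (rule ccontr)
      assume none: "\<nexists>xs ys w. covering_cycle E X Y xs ys w"
      \<comment> \<open>Adding an edge lowers no degree, so both degree conditions persist.\<close>
      have "\<exists>xs ys w. covering_cycle ?E X Y xs ys w"
      proof (rule less.hyps)
        show "card {p \<in> X \<times> Y. \<not> ?E (fst p) (snd p)} < card {p \<in> X \<times> Y. \<not> E (fst p) (snd p)}"
        proof (intro psubset_card_mono psubsetI)
          have "(x, y) \<in> {p \<in> X \<times> Y. \<not> E (fst p) (snd p)} - {p \<in> X \<times> Y. \<not> ?E (fst p) (snd p)}"
            using xy by simp
          then show "{p \<in> X \<times> Y. \<not> ?E (fst p) (snd p)} \<noteq> {p \<in> X \<times> Y. \<not> E (fst p) (snd p)}"
            by blast
        qed (use fin in auto)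
        show "h \<le> card {v \<in> Y. ?E u v}" if "u \<in> X" for u
          using fin by (intro order_trans[OF less.prems(1)[OF that]] card_mono) auto
        show "d \<le> card {u \<in> X. ?E u v}" if "v \<in> Y" for v
          using fin by (intro order_trans[OF less.prems(2)[OF that]] card_mono) auto
      qed
      then obtain xs ys where path: "covering_path E X Y xs ys" and y: "y \<in> Y - set ys"
        and hd: "hd xs = x" and last: "E (last xs) y"
        using covering_path_of_added_edge[OF _ none card(1)] by blast
      define A where "A = {z \<in> Y - set ys. E (hd xs) z}"
      define B where "B = {z \<in> Y - set ys. E (last xs) z}"
      have path': "set xs = X" "distinct xs" "distinct ys" "set ys \<subseteq> Y" "length xs = Suc (length ys)"
        using path by (auto simp: covering_path_def alternating_def)
      have bound: "h \<le> card {v \<in> set ys. E u v} + card {z \<in> Y - set ys. E u z}" if "u \<in> X" for u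
      proof -
        have "{v \<in> Y. E u v} = {v \<in> set ys. E u v} \<union> {z \<in> Y - set ys. E u z}"
          using path'(4) by auto
        moreover have "card \<dots> \<le> card {v \<in> set ys. E u v} + card {z \<in> Y - set ys. E u z}"
          by (rule card_Un_le)
        ultimately show ?thesis using less.prems(1)[OF that] by simp
      qed
      have "card (set ys) = card X - 1"
        using path' distinct_card[of xs] distinct_card[of ys] by simp
      then have "card (Y - set ys) = card Y - (card X - 1)"
        using path'(4) by (simp add: card_Diff_subset)
      \<comment> \<open>A common node would close the path into a covering cycle.\<close>
      moreover have "A \<inter> B = {}"
        using none path by (auto simp: A_def B_def covering_cycle_def)
      then have "card A + card B \<le> card (Y - set ys)"
        using fin by (subst card_Un_disjoint[symmetric]) (auto simp: A_def B_def intro!: card_mono)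
      ultimately have AB: "card A + card B \<le> card Y + 1 - card X" using card by linarith
      have "hd xs \<in> X" "last xs \<in> X"
        using path' covering_path_ne[OF path] by auto
      \<comment> \<open>\<open>y\<close> has at least \<open>d\<close> neighbours, and
        \<open>hd xs\<close> has at least \<open>h\<close>, of which \<open>card A\<close> lie off
        the path.\<close>
      have "d + h \<le> card X + card A"
        using crossing_bound[OF path y last none] less.prems(2)[of y] bound[OF \<open>hd xs \<in> X\<close>] y
        by (auto simp: A_def)
      \<comment> \<open>The reversed path ends at \<open>hd xs\<close>, which is adjacent to
        \<open>z\<close>, so the same bound applies with \<open>B\<close>.\<close>
      moreover have "d + h \<le> card X + card B" if z: "z \<in> A" for z
      proof -
        have "card {x\<in>X. E x z} + card {y\<in>set (rev ys). E (hd (rev xs)) y} \<le> card X"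
          using z covering_path_ne[OF path]
          by (intro crossing_bound[OF covering_path_rev[OF path] _ _ none]) (auto simp: A_def last_rev)
        then show ?thesis
          using less.prems(2)[of z] bound[OF \<open>last xs \<in> X\<close>] z covering_path_ne[OF path]
          by (auto simp: A_def B_def hd_rev)
      qed
      \<comment> \<open>If \<open>A\<close> is empty, the first bound gives at most
        \<open>2 * card X\<close>, hence at most \<open>card X + card Y\<close>, for
        \<open>2 * (d + h)\<close>; otherwise both bounds and \<open>AB\<close> give at most
        \<open>card X + card Y + 1\<close>. The assumed degree sum exceeds either.\<close>
      ultimately have "d + h \<le> card X \<or> 2 * (d + h) \<le> 2 * card X + (card A + card B)"
        by (cases "A = {}") (simp, fastforce)
      then show False using AB sum card by (elim disjE) (simp_all, arith?)
    qed
  qed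
qed

section \<open>Berge cycles from covering cycles of the incidence graph\<close>

text \<open>\<open>w\<close> becomes the first vertex, which shifts \<open>ys\<close> by one against
  \<open>xs\<close>: \<open>e i\<close> joins \<open>v i\<close> to \<open>v (i + 1)\<close>, and
  the last edge returns to \<open>w\<close>.\<close>

lemma is_cycle_of_covering_cycle:
  assumes "covering_cycle (\<lambda>e v. v \<in> ends H e) (edges H) (verts H) xs ys w" "card (edges H) \<ge> 2"
  shows "is_cycle H (card (edges H))"
proof -
  let ?t = "card (edges H)"
  have *: "alternating (\<lambda>e v. v \<in> ends H e) xs ys" "distinct xs" "distinct ys" "set xs = edges H"
    "set ys \<subseteq> verts H" "w \<in> verts H" "w \<notin> set ys" "w \<in> ends H (hd xs)" "w \<in> ends H (last xs)"
    using assms by (auto simp: covering_cycle_def covering_path_def)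
  have len: "length xs = ?t" "Suc (length ys) = ?t"
    using * distinct_card[of xs] by (auto simp: alternating_def)
  define v where "v i = (w # ys) ! (i - 1)" for i
  define e where "e i = xs ! (i - 1)" for i
  have pred: "(\<lambda>i. i - 1) ` {1..?t} = {..<?t}"
    by (force simp: image_iff intro: bexI[of _ "Suc _"])
  have "e ` {1..?t} = (\<lambda>i. xs ! i) ` ((\<lambda>i. i - 1) ` {1..?t})"
    by (simp add: e_def image_image)
  then have "edges H = e ` {1..?t}"
    unfolding pred using *(4) len(1) by (auto simp: set_conv_nth)
  moreover have "v ` {1..?t} = (\<lambda>i. (w # ys) ! i) ` ((\<lambda>i. i - 1) ` {1..?t})"
    by (simp add: v_def image_image)
  then have "v ` {1..?t} = set (w # ys)"
    unfolding pred set_conv_nth using len(2) by auto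
  then have "v ` {1..?t} \<subseteq> verts H" using * by simp
  moreover have "inj_on e {1..?t}"
    using *(2) len(1) by (auto simp: inj_on_def e_def nth_eq_iff_index_eq)
  moreover have "distinct (w # ys)" using * by simp
  then have "inj_on v {1..?t}"
    unfolding inj_on_def v_def using len(2) by (auto simp: nth_eq_iff_index_eq simp del: distinct.simps)
  moreover have "{v i, v (if i = ?t then 1 else i + 1)} \<subseteq> ends H (e i)" if i: "i \<in> {1..?t}" for i
  proof -
    have ne: "xs \<noteq> []" using len assms(2) by auto
    obtain j where j: "i = Suc j" "j < ?t" using i by (cases i) auto
    have "v i \<in> ends H (e i)"
    proof (cases j)
      case 0
      then show ?thesis using * j ne by (simp add: v_def e_def hd_conv_nth)
    next
      case (Suc m)
      then show ?thesis using *(1) j len by (simp add: v_def e_def alternating_def)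
    qed
    moreover have "v (if i = ?t then 1 else i + 1) \<in> ends H (e i)"
    proof (cases "i = ?t")
      case True
      then show ?thesis using *(9) j ne len by (simp add: v_def e_def last_conv_nth)
    next
      case False
      then have "j < length ys" using j len by auto
      then show ?thesis using False *(1) j by (simp add: v_def e_def alternating_def)
    qed
    ultimately show ?thesis by simp
  qed
  ultimately show ?thesis
    unfolding is_cycle_def using assms(2) by blast
qed

section \<open>Degree averages and the numerical hypothesis\<close>

lemma sum_degrees:
  assumes "finite V" "finite F" "\<And>e. e \<in> F \<Longrightarrow> g e \<subseteq> V \<and> card (g e) = h"
  shows "(\<Sum>x\<in>V. card {e\<in>F. x \<in> g e}) = card F * h"
proof -
  have "(\<Sum>x\<in>V. card {e\<in>F. x \<in> g e}) = (\<Sum>e\<in>F. card {x\<in>V. x \<in> g e})"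
    using assms(1,2) by (rule sum_multicount_gen) simp
  also have "\<dots> = (\<Sum>e\<in>F. h)"
  proof (rule sum.cong)
    fix e assume "e \<in> F"
    then have "{x\<in>V. x \<in> g e} = g e" "card (g e) = h" using assms(3) by auto
    then show "card {x\<in>V. x \<in> g e} = h" by simp
  qed simp
  finally show ?thesis by simp
qed

text \<open>If \<open>f y\<close> fell below the rounded-down average, balance would keep every
  value at most that number, with one strictly smaller, and the sum would be too small.\<close>

lemma balanced_ge_average:
  fixes f :: "'a \<Rightarrow> nat"
  assumes "finite V" "\<And>x y. x \<in> V \<Longrightarrow> y \<in> V \<Longrightarrow> f x \<le> f y + 1" "y \<in> V"
  shows "(\<Sum>x\<in>V. f x) div card V \<le> f y"
proof (rule ccontr)
  let ?q = "(\<Sum>x\<in>V. f x) div card V"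
  assume "\<not> ?q \<le> f y"
  then have less: "f y < ?q" by simp
  then have "f x \<le> ?q" if "x \<in> V" for x using assms(2)[OF that assms(3)] by linarith
  then have "(\<Sum>x\<in>V. f x) < (\<Sum>x\<in>V. ?q)"
    using less assms(1,3) by (intro sum_strict_mono_ex1) auto
  then have "(\<Sum>x\<in>V. f x) < card V * ?q" by simp
  then show False
    using times_div_less_eq_dividend[of "card V" "\<Sum>x\<in>V. f x"] by linarith
qed

text \<open>If both \<open>d\<close> and \<open>d + 1\<close> occurred, the average would lie
  strictly between two consecutive integers.\<close>

lemma almost_constant_integral_average:
  fixes f :: "'a \<Rightarrow> nat"
  assumes "finite V" "\<And>x. x \<in> V \<Longrightarrow> f x = d \<or> f x = d + 1" "(\<Sum>x\<in>V. f x) = card V * q"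
  shows "\<exists>d. \<forall>x\<in>V. f x = d"
proof -
  have range: "d \<le> f x" "f x \<le> d + 1" if "x \<in> V" for x
    using assms(2)[OF that] by auto
  show ?thesis
  proof (cases "q \<le> d")
    case True
    have "f x = d" if "x \<in> V" for x
    proof (rule ccontr)
      assume "f x \<noteq> d"
      then have "d < f x" using range[OF that] by simp
      then have "(\<Sum>x\<in>V. d) < (\<Sum>x\<in>V. f x)"
        using assms(1) that range by (intro sum_strict_mono_ex1) blast+
      then show False using True assms(3) by simp
    qed
    then show ?thesis by blast
  next
    case False
    have "f x = d + 1" if "x \<in> V" for x
    proof (rule ccontr)
      assume "f x \<noteq> d + 1"
      then have "f x < d + 1" using range[OF that] by simp
      then have "(\<Sum>x\<in>V. f x) < (\<Sum>x\<in>V. d + 1)"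
        using assms(1) that range by (intro sum_strict_mono_ex1) blast+
      then have "card V * q < card V * (d + 1)" using assms(3) by simp
      then show False using False by (simp only: mult_less_cancel1) linarith
    qed
    then show ?thesis by blast
  qed
qed

lemma is_cycle_card_edges: "is_cycle H t \<Longrightarrow> finite (edges H) \<and> card (edges H) = t"
  by (auto simp: is_cycle_def card_image)

lemma card_edges_complete_hypergraph:
  "finite V \<Longrightarrow> card (edges (complete_hypergraph lam V h)) = lam * (card V choose h)"
  by (simp add: complete_hypergraph_def card_cartesian_product n_subsets)

text \<open>Multiplying the hypothesis by \<open>(n + c) / n\<close> clears the denominator and
  turns \<open>h\<close> into \<open>h + c * h / n\<close>. The resulting summand \<open>e\<close>
  on the left is exactly what rounding \<open>c * h / n\<close> down costs on the right.\<close>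

lemma degree_sum_bound:
  fixes n h c :: nat
  defines "e \<equiv> real (c * h) / real n - real_of_int \<lfloor>real (c * h) / real n\<rfloor>"
  assumes n: "n \<ge> 1" and h: "real h \<ge> real n / 2 + real n * (1 + e) / (real n + real c)"
  shows "c + n + 2 \<le> 2 * (h + c * h div n)" and "n \<le> 2 * h"
proof -
  have e: "e = real (c * h) / real n - real (c * h div n)"
    by (simp only: e_def floor_divide_of_nat_eq of_int_of_nat_eq)
  have "e \<ge> 0" unfolding e_def by linarith
  then have "real h \<ge> real n / 2" using h n
    by (smt (verit) divide_nonneg_nonneg mult_nonneg_nonneg of_nat_0_le_iff)
  then show "n \<le> 2 * h" by linarith
  have pos: "real n > 0" "real n + real c > 0" using n by simp_all
  have "(real n / 2 + real n * (1 + e) / (real n + real c)) * ((real n + real c) / real n) =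
      (real n + real c) / 2 + (1 + e)"
  proof -
    have "(real n / 2 + real n * a / s) * (s / real n) = s / 2 + a" if "s > 0" for a s
      using that pos(1) by (simp add: field_simps)
    then show ?thesis using pos(2) by blast
  qed
  moreover have "(real n / 2 + real n * (1 + e) / (real n + real c)) * ((real n + real c) / real n) \<le>
      real h * ((real n + real c) / real n)"
    using h pos by (intro mult_right_mono) auto
  moreover have "real h * ((real n + real c) / real n) = real h + real (c * h) / real n"
    using pos by (simp add: field_simps)
  ultimately have "(real n + real c) / 2 + 1 \<le> real h + real (c * h div n)"
    using e by linarith
  then have "real (c + n + 2) \<le> real (2 * (h + c * h div n))" by (simp add: field_simps)
  then show "c + n + 2 \<le> 2 * (h + c * h div n)" by (simp only: of_nat_le_iff)
qed

section \<open>Decompositions of the complete hypergraph into almost regular spanning cycles\<close>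

theorem theorem2p5:
  fixes V :: "'v set" and c :: "nat \<Rightarrow> nat" and k n h lam :: nat and eps :: "nat \<Rightarrow> real"
  assumes "finite V" and "card V = n"
    and "k \<ge> 1" and "n \<ge> 1" and "h \<ge> 1" and "lam \<ge> 1"
    and "2 \<le> c 1" and "mono_on {1..k} c" and "c k \<le> n"
    and "\<And>i. i \<in> {1..k} \<Longrightarrow>
           eps i = real (c i * h) / real n - real_of_int \<lfloor>real (c i * h) / real n\<rfloor>"
    and "\<And>i. i \<in> {1..k} \<Longrightarrow>
           real h \<ge> real n / 2 + real n * (1 + eps i) / (real n + real (c i))"
  shows "((\<exists>P. almost_regular_spanning_cycle_decomposition (complete_hypergraph lam V h) k c P)
            \<longleftrightarrow> (\<Sum>i=1..k. c i) = lam * (n choose h)) \<and>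
         (\<forall>P. almost_regular_spanning_cycle_decomposition (complete_hypergraph lam V h) k c P \<longrightarrow>
            (\<forall>i\<in>{1..k}. eps i = 0 \<longrightarrow> regular (edge_sub (complete_hypergraph lam V h) (P i))))"
proof -
  let ?H = "complete_hypergraph lam V h"
  let ?S = "almost_regular_spanning_cycle_decomposition ?H k c"
  have n: "n \<ge> 1" by fact
  have finH: "finite (edges ?H)" using assms(1) by (simp add: complete_hypergraph_def)
  have cardH: "card (edges ?H) = lam * (n choose h)"
    using card_edges_complete_hypergraph[OF assms(1)] assms(2) by simp
  have ends: "ends ?H e \<subseteq> V \<and> card (ends ?H e) = h" if "e \<in> edges ?H" for e
    using that by (auto simp: complete_hypergraph_def)
  have c: "2 \<le> c i \<and> c i \<le> n" if "i \<in> {1..k}" for i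
  proof -
    have "c 1 \<le> c i" "c i \<le> c k"
      using that assms(3,8) by (auto intro: mono_onD)
    then show ?thesis using assms(7,9) by linarith
  qed
  have part: "P i \<subseteq> edges ?H" "card (P i) = c i" "finite (P i)"
    if "?S P" "i \<in> {1..k}" for P i
    using that is_cycle_card_edges[of "edge_sub ?H (P i)" "c i"]
    by (auto simp: almost_regular_spanning_cycle_decomposition_def decomposition_def edge_sub_def)
  have deg_sum: "(\<Sum>x\<in>V. card {e\<in>F. x \<in> ends ?H e}) = card F * h" if "F \<subseteq> edges ?H" for F
    using that ends finite_subset[OF that finH] assms(1) by (intro sum_degrees) auto
  \<comment> \<open>A cycle of length \<open>c i\<close> has exactly \<open>c i\<close> edges, so
    counting all edges part by part gives necessity.\<close>
  have "(\<Sum>i=1..k. c i) = lam * (n choose h)" if "?S P" for P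
  proof -
    have "card (\<Union>i\<in>{1..k}. P i) = (\<Sum>i\<in>{1..k}. card (P i))"
      using that part(3)[OF that]
      by (intro card_UN_disjoint)
        (auto simp: almost_regular_spanning_cycle_decomposition_def decomposition_def
          disjoint_family_on_def)
    then show ?thesis
      using that part(2)[OF that] cardH
      by (simp add: almost_regular_spanning_cycle_decomposition_def decomposition_def)
  qed
  moreover have "\<exists>P. ?S P" if sum: "(\<Sum>i=1..k. c i) = lam * (n choose h)"
  proof -
    obtain f where f: "f ` edges ?H \<subseteq> {1..k}" "\<forall>i\<in>{1..k}. card {e\<in>edges ?H. f e = i} = c i"
      "\<forall>i\<in>{1..k}. \<forall>x\<in>V. \<forall>y\<in>V.
         class_degree (edges ?H) f i x \<le> class_degree (edges ?H) f i y + 1"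
      using balanced_colouring[OF assms(1), of "{1..k}" h lam c] sum cardH
      by (auto simp: complete_hypergraph_def)
    define P where "P i = {e\<in>edges ?H. f e = i}" for i
    have cycle: "is_cycle (edge_sub ?H (P i)) (c i) \<and> spanning (edge_sub ?H (P i)) \<and>
        almost_regular (edge_sub ?H (P i))" and ne: "P i \<noteq> {}" if i: "i \<in> {1..k}" for i
    proof -
      let ?d = "\<lambda>x. card {e\<in>P i. x \<in> ends ?H e}"
      have P: "P i \<subseteq> edges ?H" "card (P i) = c i" "finite (P i)"
        using f(2) i finH by (auto simp: P_def)
      have d: "?d x = class_degree (edges ?H) f i x" for x
        unfolding class_degree_def P_def
        by (rule arg_cong[of _ _ card]) (auto simp: complete_hypergraph_def)
      have bal: "?d x \<le> ?d y + 1" if "x \<in> V" "y \<in> V" for x y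
        unfolding d using f(3) i that by blast
      note num = degree_sum_bound[OF n, of "c i" h, folded assms(10)[OF i], OF assms(11)[OF i]]
      \<comment> \<open>The degrees in the class sum to \<open>c i * h\<close> over \<open>n\<close>
        vertices.\<close>
      have dq: "c i * h div n \<le> ?d x" if "x \<in> V" for x
        using balanced_ge_average[of V ?d x] assms(1,2) bal that deg_sum[OF P(1)] P(2) by simp
      show "P i \<noteq> {}" using P(2) c[OF i] by auto
      \<comment> \<open>From \<open>c i\<close> at least 2 and \<open>n \<le> 2 * h\<close>. It
        makes every degree positive, and hence the cycle spanning.\<close>
      have "n * 1 \<le> c i * h"
        using le_trans[OF num(2) mult_le_mono1[of 2 "c i" h]] c[OF i] by simp
      then have q: "1 \<le> c i * h div n"
        using n by (simp add: less_eq_div_iff_mult_less_eq)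
      have "\<exists>xs ys w. covering_cycle (\<lambda>e v. v \<in> ends ?H e) (P i) V xs ys w"
      proof (rule exists_covering_cycle)
        show "h \<le> card {v\<in>V. v \<in> ends ?H e}" if "e \<in> P i" for e
        proof -
          have "{v\<in>V. v \<in> ends ?H e} = ends ?H e" using ends[of e] P(1) that by auto
          then show ?thesis using ends[of e] P(1) that by auto
        qed
        show "card (P i) + card V + 2 \<le> 2 * (h + c i * h div n)"
          using num(1) P(2) assms(2) by simp
      qed (use P c[OF i] assms(1,2) dq in auto)
      then have "is_cycle (edge_sub ?H (P i)) (c i)"
        using is_cycle_of_covering_cycle[of "edge_sub ?H (P i)"] P(2) c[OF i]
        by (auto simp: edge_sub_def complete_hypergraph_def)
      moreover have "spanning (edge_sub ?H (P i))"
        unfolding spanning_def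
      proof
        fix x assume "x \<in> verts (edge_sub ?H (P i))"
        then have "1 \<le> ?d x" using dq[of x] q by (simp add: edge_sub_def complete_hypergraph_def)
        then have "{e\<in>P i. x \<in> ends ?H e} \<noteq> {}" by (metis card.empty not_one_le_zero)
        then show "\<exists>e\<in>edges (edge_sub ?H (P i)). x \<in> ends (edge_sub ?H (P i)) e"
          by (auto simp: edge_sub_def)
      qed
      moreover have "almost_regular (edge_sub ?H (P i))"
      proof -
        have "V \<noteq> {}" using n assms(2) by auto
        \<comment> \<open>The minimum degree serves as the lower of the two values; balance bounds
          the others by one more.\<close>
        then obtain x0 where x0: "x0 \<in> V" "\<And>x. x \<in> V \<Longrightarrow> ?d x0 \<le> ?d x"
          using ex_has_least_nat[of "\<lambda>x. x \<in> V" _ ?d] by blast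
        have "?d x = ?d x0 \<or> ?d x = ?d x0 + 1" if "x \<in> V" for x
          using x0(2)[OF that] bal[OF that x0(1)] by linarith
        then show ?thesis
          unfolding almost_regular_def degree_def edge_sub_def
          by (intro exI[of _ "?d x0"]) (simp add: complete_hypergraph_def)
      qed
      ultimately show "is_cycle (edge_sub ?H (P i)) (c i) \<and> spanning (edge_sub ?H (P i)) \<and>
        almost_regular (edge_sub ?H (P i))" by blast
    qed
    have "disjoint_family_on P {1..k}" "(\<Union>i\<in>{1..k}. P i) = edges ?H"
      using f(1) by (auto simp: P_def disjoint_family_on_def)
    then have "?S P"
      using cycle ne by (simp add: almost_regular_spanning_cycle_decomposition_def decomposition_def)
    then show ?thesis by blast
  qed
  moreover have "regular (edge_sub ?H (P i))" if P: "?S P" and i: "i \<in> {1..k}" and "eps i = 0" for P i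
  proof -
    let ?d = "\<lambda>x. card {e\<in>P i. x \<in> ends ?H e}"
    \<comment> \<open>A zero fractional part means that \<open>n\<close> divides
      \<open>c i * h\<close>, so the average degree is an integer. The argument applies to every
      decomposition, not only to the one constructed above.\<close>
    have "real (c i * h) / real n = real (c i * h div n)"
      using \<open>eps i = 0\<close> unfolding assms(10)[OF i] floor_divide_of_nat_eq by simp
    then have "real (c i * h) = real (n * (c i * h div n))" using n by (simp add: field_simps)
    then have "c i * h = n * (c i * h div n)" by (simp only: of_nat_eq_iff)
    then have sum: "(\<Sum>x\<in>V. ?d x) = card V * (c i * h div n)"
      using deg_sum[OF part(1)[OF P i]] part(2)[OF P i] assms(2) by simp
    have "almost_regular (edge_sub ?H (P i))"
      using P i by (simp add: almost_regular_spanning_cycle_decomposition_def)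
    then obtain d where "\<And>x. x \<in> V \<Longrightarrow> ?d x = d \<or> ?d x = d + 1"
      by (auto simp: almost_regular_def degree_def edge_sub_def complete_hypergraph_def)
    from almost_constant_integral_average[OF assms(1) this sum] show ?thesis
      by (simp add: regular_def degree_def edge_sub_def complete_hypergraph_def)
  qed
  ultimately show ?thesis by blast
qed

end
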